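(* Let $G(\mathbf p)\subseteq\mathbb R^d$ be a tensegrity framework on a tensegrity graph $G=([n],E)$ with bars $B$, cables $C$, struts $S$, let $P\in\mathbb R^{n\times d}$ be its framework matrix, and let $Z\in\mathcal S^n_+$ be a spherical stress matrix for $G(\mathbf p)$. Then $G(\mathbf p)$ dominates a framework $G(\mathbf q)$ if and only if $$\mathrm{Gram}(q_1,\dots,q_n)=PP^T+PRP^T$$ for some symmetric $d\times d$ matrix $R$ satisfying: (a) $\operatorname{im}R\subseteq\operatorname{span}(p_1,\dots,p_n)$; (b) $p_i^TRp_j=0$ for $i=j$ and for $ij\in B\cup\{\ell k\in C\cup S: Z_{\ell k}\neq 0\}$; (c) $p_i^TRp_j\ge 0$ for $ij\in C$; (d) $p_i^TRp_j\le 0$ for $ij\in S$.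
   Context: A tensegrity graph is a graph $G=([n],E)$ whose edge set is partitioned into three disjoint sets $B$ (bars), $C$ (cables) and $S$ (struts). A tensegrity framework $G(\mathbf p)$ consists of a tensegrity graph and an assignment of real column vectors $\mathbf p=(p_1,\dots,p_n)$ to its vertices; if all $p_i\in\mathbb R^d$ we write $G(\mathbf p)\subseteq\mathbb R^d$, and the framework matrix is the $n\times d$ matrix $P$ whose $i$-th row is $p_i^T$. $\mathrm{Gram}(p_1,\dots,p_n)=PP^T$ is the matrix of inner products $p_i^Tp_j$. For frameworks $G(\mathbf p)$ and $G(\mathbf q)$ (the $q_i$ may lie in a real space of any dimension), $G(\mathbf p)$ dominates $G(\mathbf q)$ if $q_i^Tq_j=p_i^Tp_j$ for $ij\in B$ and for $i=j$, $q_i^Tq_j\ge p_i^Tp_j$ for $ij\in C$, and $q_i^Tq_j\le p_i^Tp_j$ for $ij\in S$. A spherical stress matrix for $G(\mathbf p)$ is a matrix $Z\in\mathcal S^n$ such that: (i) $Z$ is positive semidefinite; (ii) $Z_{ij}=0$ whenever $i\ne j$ and $ij\notin E$; (iii) $Z_{ij}\ge0$ for all $ij\in S$ and $Z_{ij}\le 0$ for all $ij\in C$; (iv) $ZP=0$; (v) $\dim\ker Z=\dim\operatorname{span}(p_1,\dots,p_n)$. $\mathcal S^n$ ($\mathcal S^n_+$) denotes real symmetric (positive semidefinite) $n\times n$ matrices. *)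

theory Defs
  imports "HOL-Analysis.Analysis"
begin

text \<open>
  The vertex set $[n]$ is the universe of a finite type. Edges are unordered, hence
  two-element sets of vertices; each of the three parts of the edge set may be empty.
\<close>

record 'v tensegrity =
  edges :: "'v set set"
  bars :: "'v set set"
  cables :: "'v set set"
  struts :: "'v set set"

definition tensegrity_graph :: "('v, 'z) tensegrity_scheme \<Rightarrow> bool" where
  "tensegrity_graph G \<longleftrightarrow>
     (\<forall>e \<in> edges G. card e = 2) \<and>
     edges G = bars G \<union> cables G \<union> struts G \<and>
     bars G \<inter> cables G = {} \<and> bars G \<inter> struts G = {} \<and> cables G \<inter> struts G = {}"

definition framework_matrix :: "('n::finite \<Rightarrow> real ^ 'd::finite) \<Rightarrow> real ^ 'd ^ 'n" where
  "framework_matrix p = (\<chi> i. p i)"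

definition gram :: "('n::finite \<Rightarrow> real ^ 'd::finite) \<Rightarrow> real ^ 'n ^ 'n" where
  "gram p = (\<chi> i j. p i \<bullet> p j)"

lemma gram_eq_framework_matrix:
  "gram p = framework_matrix p ** transpose (framework_matrix p)"
  by (simp add: gram_def framework_matrix_def matrix_matrix_mult_def transpose_def
      inner_vec_def vec_eq_iff)

text \<open>The two frameworks may lie in spaces of different dimensions.\<close>

definition dominates ::
  "('n::finite, 'z) tensegrity_scheme \<Rightarrow> ('n \<Rightarrow> real ^ 'd::finite) \<Rightarrow> ('n \<Rightarrow> real ^ 'm::finite) \<Rightarrow> bool"
where
  "dominates G p q \<longleftrightarrow>
     (\<forall>i j. i = j \<or> {i, j} \<in> bars G \<longrightarrow> q i \<bullet> q j = p i \<bullet> p j) \<and>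
     (\<forall>i j. {i, j} \<in> cables G \<longrightarrow> q i \<bullet> q j \<ge> p i \<bullet> p j) \<and>
     (\<forall>i j. {i, j} \<in> struts G \<longrightarrow> q i \<bullet> q j \<le> p i \<bullet> p j)"

definition symmetric_matrix :: "real ^ 'n ^ 'n::finite \<Rightarrow> bool" where
  "symmetric_matrix A \<longleftrightarrow> transpose A = A"

definition psd_matrix :: "real ^ 'n ^ 'n::finite \<Rightarrow> bool" where
  "psd_matrix A \<longleftrightarrow> symmetric_matrix A \<and> (\<forall>x. x \<bullet> (A *v x) \<ge> 0)"

definition spherical_stress_matrix ::
  "('n::finite, 'z) tensegrity_scheme \<Rightarrow> ('n \<Rightarrow> real ^ 'd::finite) \<Rightarrow> real ^ 'n ^ 'n \<Rightarrow> bool"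
where
  "spherical_stress_matrix G p Z \<longleftrightarrow>
     psd_matrix Z \<and>
     (\<forall>i j. i \<noteq> j \<and> {i, j} \<notin> edges G \<longrightarrow> Z $ i $ j = 0) \<and>
     (\<forall>i j. {i, j} \<in> struts G \<longrightarrow> Z $ i $ j \<ge> 0) \<and>
     (\<forall>i j. {i, j} \<in> cables G \<longrightarrow> Z $ i $ j \<le> 0) \<and>
     Z ** framework_matrix p = 0 \<and>
     dim {x. Z *v x = 0} = dim (span (range p))"

end

theory Submission
  imports Defs
begin

text \<open>
  Pairing the stress \<open>Z\<close> with the difference of the Gram matrices of \<open>q\<close> and \<open>p\<close> gives a
  number that is nonpositive entry by entry, by domination and the sign conditions, and
  nonnegative, because \<open>Z\<close> is positive semidefinite and \<open>ZP = 0\<close>. So every entry contributes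
  zero and each coordinate of \<open>q\<close>, as a vector indexed by the vertices, lies in the kernel
  of \<open>Z\<close>. By the rank condition this kernel is the column space of \<open>P\<close>; hence \<open>Q = PA\<close> with
  the columns of \<open>A\<close> in the row space of \<open>P\<close>, and likewise \<open>P = PB\<close>. Then
  \<open>R = AA\<^sup>T - BB\<^sup>T\<close> is the required matrix.
\<close>

text \<open>Moving from \<open>x\<close> against \<open>y = A *v x\<close> changes the form to first
  order by a multiple of \<open>y \<bullet> y\<close>; since the form starts at its minimum 0,
  \<open>y\<close> must vanish.\<close>

lemma psd_matrix_kernel:
  assumes "psd_matrix A" and "x \<bullet> (A *v x) = 0"
  shows "A *v x = 0"
proof -
  define y where "y = A *v x"
  define b where "b = y \<bullet> (A *v y)"
  define c where "c = y \<bullet> y"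
  \<comment> \<open>The optimal step would be \<open>c / b\<close>; the added 1 keeps the
    denominator positive even for \<open>b = 0\<close>, and the form still comes out as
    \<open>- (s * s * (b + 2))\<close>.\<close>
  define s where "s = c / (b + 1)"
  have nonneg: "z \<bullet> (A *v z) \<ge> 0" for z
    using assms(1) by (simp add: psd_matrix_def)
  have b: "b \<ge> 0"
    unfolding b_def by (rule nonneg)
  then have c: "c = s * (b + 1)"
    by (simp add: s_def)
  have "transpose A = A"
    using assms(1) by (simp add: psd_matrix_def symmetric_matrix_def)
  then have sym: "x \<bullet> (A *v y) = c"
    unfolding c_def by (metis dot_lmul_matrix transpose_matrix_vector y_def)
  have "0 \<le> (x - s *\<^sub>R y) \<bullet> (A *v (x - s *\<^sub>R y))"
    by (rule nonneg)
  also have "\<dots> = s * s * b - 2 * s * c"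
    using assms(2) sym
    by (simp add: matrix_vector_mult_diff_distrib matrix_vector_mult_scaleR inner_diff
        b_def c_def algebra_simps flip: y_def)
  also have "\<dots> = - (s * s * (b + 2))"
    using c by (simp add: algebra_simps)
  finally have "s = 0"
    using b by (smt (verit) mult_pos_pos not_real_square_gt_zero)
  then have "c = 0"
    using c by simp
  then show ?thesis
    by (simp add: c_def y_def)
qed

lemma framework_matrix_mult_vec [simp]: "(framework_matrix p *v x) $ i = p i \<bullet> x"
  by (simp add: framework_matrix_def matrix_vector_mult_def inner_vec_def)

lemma framework_matrix_congruence:
  "(framework_matrix p ** R ** transpose (framework_matrix p)) $ i $ j = p i \<bullet> (R *v p j)"
proof -
  have "(framework_matrix p ** R ** transpose (framework_matrix p)) $ i $ j
      = (\<Sum>k\<in>UNIV. (\<Sum>l\<in>UNIV. p i $ l * R $ l $ k) * p j $ k)"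
    by (simp add: matrix_matrix_mult_def transpose_def framework_matrix_def)
  also have "\<dots> = (\<Sum>k\<in>UNIV. \<Sum>l\<in>UNIV. p i $ l * (R $ l $ k * p j $ k))"
    by (simp add: sum_distrib_right mult.assoc)
  also have "\<dots> = (\<Sum>l\<in>UNIV. \<Sum>k\<in>UNIV. p i $ l * (R $ l $ k * p j $ k))"
    by (rule sum.swap)
  also have "\<dots> = p i \<bullet> (R *v p j)"
    by (simp add: inner_vec_def matrix_vector_mult_def sum_distrib_left)
  finally show ?thesis .
qed

lemma rank_framework_matrix: "dim (span (range p)) = rank (framework_matrix p)"
proof -
  have "rows (framework_matrix p) = range p"
    by (auto simp: rows_def row_def framework_matrix_def)
  then show ?thesis
    by (simp add: row_rank_def)
qed

text \<open>\<open>ZP = 0\<close> gives one inclusion. The rank condition speaks of the row space of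
  \<open>P\<close>, and equality of row and column rank turns it into equality of
  dimensions.\<close>

lemma stress_kernel:
  assumes "spherical_stress_matrix G p Z"
  shows "{x. Z *v x = 0} = range ((*v) (framework_matrix p))"
proof -
  have "range ((*v) (framework_matrix p)) = {x. Z *v x = 0}"
  proof (rule subspace_dim_equal)
    show "range ((*v) (framework_matrix p)) \<subseteq> {x. Z *v x = 0}"
      using assms by (auto simp: spherical_stress_matrix_def matrix_vector_mul_assoc)
    show "dim {x. Z *v x = 0} \<le> dim (range ((*v) (framework_matrix p)))"
      using assms
      by (simp only: spherical_stress_matrix_def rank_framework_matrix rank_dim_range)
    show "subspace {x. Z *v x = 0}"
      by (simp add: subspace_def matrix_vector_right_distrib matrix_vector_mult_scaleR)
    show "subspace (range ((*v) (framework_matrix p)))"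
      by (simp add: linear_subspace_image)
  qed
  then show ?thesis ..
qed

text \<open>The vectors \<open>a k\<close> are the columns of \<open>A\<close> in
  \<open>Q = PA\<close>. Any preimage may be projected orthogonally onto the span of the
  \<open>p i\<close>, since the discarded part is orthogonal to all of them; the range condition on
  \<open>R\<close> rests on this choice.\<close>

lemma range_framework_matrix_factor:
  fixes p :: "'n::finite \<Rightarrow> real ^ 'd::finite"
  assumes "\<And>k. (\<chi> i. q i $ k) \<in> range ((*v) (framework_matrix p))"
  obtains a where "\<And>k. a k \<in> span (range p)" and "\<And>i k. q i $ k = p i \<bullet> a k"
proof -
  have "\<exists>a\<in>span (range p). \<forall>i. q i $ k = p i \<bullet> a" for k
  proof -
    obtain x where x: "(\<chi> i. q i $ k) = framework_matrix p *v x"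
      using assms[of k] by blast
    obtain y z where y: "y \<in> span (range p)"
      and z: "\<And>w. w \<in> span (range p) \<Longrightarrow> orthogonal z w" and "x = y + z"
      using orthogonal_subspace_decomp_exists by metis
    have "q i $ k = p i \<bullet> y" for i
    proof -
      have "q i $ k = p i \<bullet> x"
        using arg_cong[OF x, of "\<lambda>v. v $ i"] by simp
      also have "\<dots> = p i \<bullet> y"
        using z[of "p i"] \<open>x = y + z\<close>
        by (simp add: span_base orthogonal_def inner_right_distrib inner_commute)
      finally show ?thesis .
    qed
    with y show ?thesis by blast
  qed
  then show ?thesis
    using that by metis
qed

text \<open>This is tr(Z Q Q^T) = tr(Q^T Z Q), with the second trace taken over the columns of
  \<open>Q\<close>.\<close>

lemma stress_gram_sum:
  fixes q :: "'n::finite \<Rightarrow> real ^ 'm::finite" and Z :: "real ^ 'n ^ 'n"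
  shows "(\<Sum>i\<in>UNIV. \<Sum>j\<in>UNIV. Z $ i $ j * (q i \<bullet> q j))
    = (\<Sum>k\<in>UNIV. (\<chi> i. q i $ k) \<bullet> (Z *v (\<chi> i. q i $ k)))"
proof -
  have "(\<Sum>i\<in>UNIV. \<Sum>j\<in>UNIV. Z $ i $ j * (q i \<bullet> q j))
      = (\<Sum>i\<in>UNIV. \<Sum>j\<in>UNIV. \<Sum>k\<in>UNIV. q i $ k * (Z $ i $ j * q j $ k))"
    by (simp add: inner_vec_def sum_distrib_left mult_ac)
  also have "\<dots> = (\<Sum>i\<in>UNIV. \<Sum>k\<in>UNIV. \<Sum>j\<in>UNIV. q i $ k * (Z $ i $ j * q j $ k))"
    by (intro sum.cong refl sum.swap)
  also have "\<dots> = (\<Sum>k\<in>UNIV. \<Sum>i\<in>UNIV. \<Sum>j\<in>UNIV. q i $ k * (Z $ i $ j * q j $ k))"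
    by (rule sum.swap)
  also have "\<dots> = (\<Sum>k\<in>UNIV. (\<chi> i. q i $ k) \<bullet> (Z *v (\<chi> i. q i $ k)))"
    by (simp add: inner_vec_def matrix_vector_mult_def sum_distrib_left)
  finally show ?thesis .
qed

text \<open>On the diagonal and on bars the difference vanishes, off the edges \<open>Z\<close>
  does; on cables both factors are nonpositive, on struts both are nonnegative.\<close>

lemma dominates_stress_term_nonneg:
  assumes "tensegrity_graph G" "spherical_stress_matrix G p Z" "dominates G p q"
  shows "0 \<le> Z $ i $ j * (p i \<bullet> p j - q i \<bullet> q j)"
proof -
  consider "i = j \<or> {i, j} \<in> bars G" | "{i, j} \<in> cables G" | "{i, j} \<in> struts G"
    | "i \<noteq> j" "{i, j} \<notin> edges G"
    using assms(1) by (auto simp: tensegrity_graph_def)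
  then show ?thesis
    using assms(2,3)
    by cases (auto simp: spherical_stress_matrix_def dominates_def mult_nonpos_nonpos)
qed

lemma dominates_complementary_slackness:
  assumes "tensegrity_graph G" "spherical_stress_matrix G p Z" "dominates G p q"
  shows "Z $ i $ j * (p i \<bullet> p j - q i \<bullet> q j) = 0"
    and "Z *v (\<chi> i. q i $ k) = 0"
proof -
  let ?t = "\<lambda>i j. Z $ i $ j * (p i \<bullet> p j - q i \<bullet> q j)"
  let ?c = "\<lambda>k. \<chi> i. q i $ k"
  have psd: "psd_matrix Z"
    using assms(2) by (simp add: spherical_stress_matrix_def)
  then have coord_nonneg: "?c k \<bullet> (Z *v ?c k) \<ge> 0" for k
    by (simp add: psd_matrix_def)
  note entry_nonneg = dominates_stress_term_nonneg[OF assms]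
  \<comment> \<open>Column \<open>l\<close> of \<open>P\<close> is the image of a unit vector, hence
    in the kernel of \<open>Z\<close>; so the \<open>p\<close> part of the sum below drops
    out.\<close>
  have col: "Z *v (\<chi> i. p i $ l) = 0" for l
  proof -
    have "(\<chi> i. p i $ l) = framework_matrix p *v axis l 1"
      by (simp add: vec_eq_iff inner_axis)
    then show ?thesis
      using stress_kernel[OF assms(2)] by blast
  qed
  have "(\<Sum>i\<in>UNIV. \<Sum>j\<in>UNIV. ?t i j)
      = (\<Sum>i\<in>UNIV. \<Sum>j\<in>UNIV. Z $ i $ j * (p i \<bullet> p j)) - (\<Sum>i\<in>UNIV. \<Sum>j\<in>UNIV. Z $ i $ j * (q i \<bullet> q j))"
    by (simp add: right_diff_distrib sum_subtractf)
  also have "\<dots> = - (\<Sum>k\<in>UNIV. ?c k \<bullet> (Z *v ?c k))"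
    by (simp add: stress_gram_sum col)
  finally have eq: "(\<Sum>i\<in>UNIV. \<Sum>j\<in>UNIV. ?t i j) = - (\<Sum>k\<in>UNIV. ?c k \<bullet> (Z *v ?c k))" .
  moreover have "(\<Sum>i\<in>UNIV. \<Sum>j\<in>UNIV. ?t i j) \<ge> 0"
    by (intro sum_nonneg entry_nonneg)
  moreover have "(\<Sum>k\<in>UNIV. ?c k \<bullet> (Z *v ?c k)) \<ge> 0"
    by (intro sum_nonneg coord_nonneg)
  ultimately have zero: "(\<Sum>i\<in>UNIV. \<Sum>j\<in>UNIV. ?t i j) = 0" "(\<Sum>k\<in>UNIV. ?c k \<bullet> (Z *v ?c k)) = 0"
    by linarith+
  have "(\<Sum>j\<in>UNIV. ?t i j) = 0"
    using zero(1) by (subst (asm) sum_nonneg_eq_0_iff) (auto intro: sum_nonneg entry_nonneg)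
  then show "?t i j = 0"
    by (subst (asm) sum_nonneg_eq_0_iff) (auto intro: entry_nonneg)
  have "?c k \<bullet> (Z *v ?c k) = 0"
    using zero(2) coord_nonneg by (simp add: sum_nonneg_eq_0_iff)
  then show "Z *v ?c k = 0"
    by (rule psd_matrix_kernel[OF psd])
qed

text \<open>This is A A^T for the matrix with columns \<open>a k\<close>. The free index type
  \<open>'k\<close> allows as many columns as \<open>q\<close> or \<open>p\<close> has
  coordinates.\<close>

definition outer_square :: "('k::finite \<Rightarrow> real ^ 'd::finite) \<Rightarrow> real ^ 'd ^ 'd" where
  "outer_square a = (\<chi> s t. \<Sum>k\<in>UNIV. a k $ s * a k $ t)"

lemma transpose_outer_square: "transpose (outer_square a) = outer_square a"
  by (simp add: outer_square_def transpose_def mult.commute)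

text \<open>Written as a combination of the \<open>a k\<close>, the image visibly stays in any
  subspace containing them.\<close>

lemma outer_square_mult_vec: "outer_square a *v x = (\<Sum>k\<in>UNIV. (a k \<bullet> x) *\<^sub>R a k)"
unfolding vec_eq_iff
proof
  fix s
  have "(outer_square a *v x) $ s = (\<Sum>t\<in>UNIV. \<Sum>k\<in>UNIV. a k $ t * x $ t * a k $ s)"
    by (simp add: outer_square_def matrix_vector_mult_def sum_distrib_left sum_distrib_right mult_ac)
  also have "\<dots> = (\<Sum>k\<in>UNIV. \<Sum>t\<in>UNIV. a k $ t * x $ t * a k $ s)"
    by (rule sum.swap)
  also have "\<dots> = (\<Sum>k\<in>UNIV. (a k \<bullet> x) *\<^sub>R a k) $ s"
    by (simp add: inner_vec_def sum_distrib_right)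
  finally show "(outer_square a *v x) $ s = (\<Sum>k\<in>UNIV. (a k \<bullet> x) *\<^sub>R a k) $ s" .
qed

text \<open>With \<open>Q = PA\<close>, this is P A A^T P^T = Q Q^T read entrywise.\<close>

lemma inner_outer_square:
  assumes "\<And>i k. q i $ k = p i \<bullet> a k"
  shows "p i \<bullet> (outer_square a *v p j) = q i \<bullet> q j"
  by (simp add: outer_square_mult_vec inner_sum_right inner_vec_def[of "q i"] assms
      inner_commute[of "a _"] mult.commute)

lemma stress_gram_difference:
  fixes p :: "'n::finite \<Rightarrow> real ^ 'd::finite" and q :: "'n \<Rightarrow> real ^ 'm::finite"
  assumes "tensegrity_graph G" "spherical_stress_matrix G p Z" "dominates G p q"
  obtains R where "symmetric_matrix R" and "range (\<lambda>x. R *v x) \<subseteq> span (range p)"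
    and "\<And>i j. p i \<bullet> (R *v p j) = q i \<bullet> q j - p i \<bullet> p j"
proof -
  have "(\<chi> i. q i $ k) \<in> range ((*v) (framework_matrix p))" for k
    using dominates_complementary_slackness(2)[OF assms] stress_kernel[OF assms(2)] by blast
  then obtain a where a: "\<And>k. a k \<in> span (range p)" "\<And>i k. q i $ k = p i \<bullet> a k"
    by (rule range_framework_matrix_factor[of q p]) blast
  \<comment> \<open>Subtracting the identity from \<open>outer_square a\<close> would give the right
    inner products but could leave the span of the \<open>p i\<close>. Factoring \<open>P\<close>
    through itself yields instead, as \<open>outer_square b\<close>, the orthogonal projection onto
    that span.\<close>
  have "(\<chi> i. p i $ k) = framework_matrix p *v axis k 1" for k
    by (simp add: vec_eq_iff inner_axis)
  then have "(\<chi> i. p i $ k) \<in> range ((*v) (framework_matrix p))" for k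
    by blast
  then obtain b where b: "\<And>k. b k \<in> span (range p)" "\<And>i k. p i $ k = p i \<bullet> b k"
    by (rule range_framework_matrix_factor[of p p]) blast
  define R where "R = outer_square a - outer_square b"
  show ?thesis
  proof
    have "transpose R = transpose (outer_square a) - transpose (outer_square b)"
      by (simp add: R_def transpose_def vec_eq_iff)
    then show "symmetric_matrix R"
      by (simp add: symmetric_matrix_def transpose_outer_square R_def)
    show "range (\<lambda>x. R *v x) \<subseteq> span (range p)"
      by (auto simp: R_def matrix_vector_mult_diff_rdistrib outer_square_mult_vec
          intro!: span_diff span_sum span_scale a(1) b(1))
    show "p i \<bullet> (R *v p j) = q i \<bullet> q j - p i \<bullet> p j" for i j
      by (simp add: R_def matrix_vector_mult_diff_rdistrib inner_diff_right
          inner_outer_square[of q p a, OF a(2)] inner_outer_square[of p p b, OF b(2)])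
  qed
qed

text \<open>Entrywise, the form of \<open>R\<close> measures the change of inner products from
  \<open>p\<close> to \<open>q\<close>, which makes the sign conditions on \<open>R\<close> those of
  domination.\<close>

lemma gram_eq_congruence_iff:
  "gram q = framework_matrix p ** transpose (framework_matrix p)
      + framework_matrix p ** R ** transpose (framework_matrix p)
    \<longleftrightarrow> (\<forall>i j. p i \<bullet> (R *v p j) = q i \<bullet> q j - p i \<bullet> p j)"
  by (auto simp: vec_eq_iff framework_matrix_congruence gram_def algebra_simps
      simp flip: gram_eq_framework_matrix)

theorem theorem2p3:
  fixes G :: "'n::finite tensegrity"
    and p :: "'n \<Rightarrow> real ^ 'd::finite"
    and q :: "'n \<Rightarrow> real ^ 'm::finite"
    and P :: "real ^ 'd ^ 'n"
    and Z :: "real ^ 'n ^ 'n"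
  assumes "tensegrity_graph G"
    and "P = framework_matrix p"
    and "spherical_stress_matrix G p Z"
  shows "dominates G p q \<longleftrightarrow>
    (\<exists>R :: real ^ 'd ^ 'd.
       symmetric_matrix R \<and>
       gram q = P ** transpose P + P ** R ** transpose P \<and>
       range (\<lambda>x. R *v x) \<subseteq> span (range p) \<and>
       (\<forall>i j. i = j \<or> {i, j} \<in> bars G \<union> {{l, k} | l k. {l, k} \<in> cables G \<union> struts G \<and> Z $ l $ k \<noteq> 0}
          \<longrightarrow> p i \<bullet> (R *v p j) = 0) \<and>
       (\<forall>i j. {i, j} \<in> cables G \<longrightarrow> p i \<bullet> (R *v p j) \<ge> 0) \<and>
       (\<forall>i j. {i, j} \<in> struts G \<longrightarrow> p i \<bullet> (R *v p j) \<le> 0))"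
    (is "_ \<longleftrightarrow> (\<exists>R. ?P R)")
proof
  assume dom: "dominates G p q"
  obtain R where R: "symmetric_matrix R" "range (\<lambda>x. R *v x) \<subseteq> span (range p)"
    and diff: "\<And>i j. p i \<bullet> (R *v p j) = q i \<bullet> q j - p i \<bullet> p j"
    using stress_gram_difference[OF assms(1,3) dom] by blast
  have "q l \<bullet> q k = p l \<bullet> p k" if "Z $ l $ k \<noteq> 0" for l k
    using dominates_complementary_slackness(1)[OF assms(1,3) dom, of l k] that by simp
  \<comment> \<open>Stressed edges are unordered pairs, so \<open>i\<close>, \<open>j\<close> may be
    \<open>l\<close>, \<open>k\<close> in either order; symmetry of the inner product covers
    both.\<close>
  then have "q i \<bullet> q j = p i \<bullet> p j" if "{i, j} = {l, k}" "Z $ l $ k \<noteq> 0" for i j l k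
    using that by (metis doubleton_eq_iff inner_commute)
  then have stressed: "\<forall>i j. i = j \<or> {i, j} \<in> bars G \<union> {{l, k} | l k. {l, k} \<in> cables G \<union> struts G \<and> Z $ l $ k \<noteq> 0}
      \<longrightarrow> p i \<bullet> (R *v p j) = 0"
    using dom by (auto simp: diff dominates_def)
  have "?P R"
    using R stressed dom
    by (simp add: assms(2) gram_eq_congruence_iff diff dominates_def)
  then show "\<exists>R. ?P R" ..
next
  assume "\<exists>R. ?P R"
  then obtain R where R: "?P R" ..
  then have "p i \<bullet> (R *v p j) = q i \<bullet> q j - p i \<bullet> p j" for i j
    by (simp add: assms(2) gram_eq_congruence_iff)
  with R show "dominates G p q"
    by (simp add: dominates_def)
qed

end
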